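(* Let $N=2^n$, let $N'$ be a positive integer, and let $H$ be a Hermitian operator on $\mathbb{C}^N$ with spectral norm $\|H\|$. Let $|\psi_0\rangle\in\mathbb{C}^N\otimes\mathbb{C}^{N'}$ be a fixed unit vector, and for a unitary $U\in\mathsf{U}(NN')$ put $|\psi(U)\rangle_{AB}=U|\psi_0\rangle$ and $\rho(U)=\mathrm{Tr}_B\big[|\psi(U)\rangle\langle\psi(U)|_{AB}\big]$. Then the function $U\mapsto\mathrm{Erg}(\rho(U))$ is Lipschitz continuous with Lipschitz constant $4\|H\|$ with respect to the Hilbert–Schmidt norm: for all $U,V\in\mathsf{U}(NN')$, $$\left|\mathrm{Erg}(\rho(U))-\mathrm{Erg}(\rho(V))\right|\le4\|H\|\,\|U-V\|_2.$$
   Context: $\mathsf{U}(k)$ is the group of $k\times k$ unitary matrices. $A$ is the first ($N$-dimensional) tensor factor, $B$ the second ($N'$-dimensional) one, and $\mathrm{Tr}_B$ is the partial trace over $B$. $\|X\|_2=\sqrt{\mathrm{Tr}[X^\dagger X]}$ is the Hilbert–Schmidt norm. For a density matrix $\rho$ on $\mathbb{C}^N$, the ergotropy with respect to $H$ is $\mathrm{Erg}(\rho)=\max_{W\in\mathsf{U}(N)}\mathrm{Tr}[H(\rho-W\rho W^\dagger)]$. *)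

theory Defs
  imports "HOL-Analysis.Analysis"
begin

text \<open>
  Linear operators on \<open>\<complex>\<^sup>N\<close> are matrices of type \<open>complex ^ 'a ^ 'a\<close> with \<open>CARD('a) = N\<close>. The tensor
  product \<open>\<complex>\<^sup>N \<otimes> \<complex>\<^sup>N\<^sup>'\<close> is \<open>complex ^ ('a \<times> 'b)\<close> with \<open>CARD('b) = N'\<close>: the component at
  \<open>(i, k)\<close> is the coefficient of the product basis vector \<open>e\<^sub>i \<otimes> f\<^sub>k\<close>. The norm of the type
  \<open>complex ^ 'a\<close> is the usual Hilbert space norm, so the spectral norm of \<open>A\<close> is \<open>onorm ((*v) A)\<close>.
\<close>

definition dagger :: "complex ^ 'n ^ 'm \<Rightarrow> complex ^ 'm ^ 'n" where
  "dagger A = (\<chi> i j. cnj (A $ j $ i))"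

definition hermitian :: "complex ^ 'n ^ 'n \<Rightarrow> bool" where
  "hermitian A \<longleftrightarrow> dagger A = A"

definition unitary_group :: "(complex ^ 'n ^ 'n) set" where
  "unitary_group = {U. dagger U ** U = mat 1 \<and> U ** dagger U = mat 1}"

definition spectral_norm :: "complex ^ 'n ^ 'n \<Rightarrow> real" where
  "spectral_norm A = onorm ((*v) A)"

definition hs_norm :: "complex ^ 'n ^ 'n \<Rightarrow> real" where
  "hs_norm X = sqrt (Re (trace (dagger X ** X)))"

definition ket_bra :: "complex ^ 'n \<Rightarrow> complex ^ 'n ^ 'n" where
  "ket_bra \<psi> = (\<chi> i j. \<psi> $ i * cnj (\<psi> $ j))"

definition partial_trace_B ::
    "complex ^ ('a::finite \<times> 'b::finite) ^ ('a \<times> 'b) \<Rightarrow> complex ^ 'a ^ 'a" where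
  "partial_trace_B X = (\<chi> i j. \<Sum>k\<in>UNIV. X $ (i, k) $ (j, k))"

text \<open>
  The trace below is a real number when \<open>H\<close> and \<open>\<rho>\<close> are Hermitian, and the maximum over the unitary
  group is attained; both facts are proved as \<open>trace_work_real\<close> and \<open>ergotropy_is_max\<close>.
\<close>

definition ergotropy :: "complex ^ 'n ^ 'n \<Rightarrow> complex ^ 'n ^ 'n \<Rightarrow> real" where
  "ergotropy H \<rho> =
    (GREATEST w. \<exists>W\<in>unitary_group. w = Re (trace (H ** (\<rho> - W ** \<rho> ** dagger W))))"

definition reduced_state ::
    "complex ^ ('a::finite \<times> 'b::finite) \<Rightarrow> complex ^ ('a \<times> 'b) ^ ('a \<times> 'b) \<Rightarrow> complex ^ 'a ^ 'a" where
  "reduced_state \<psi>\<^sub>0 U = partial_trace_B (ket_bra (U *v \<psi>\<^sub>0))"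

lemma dagger_mult: "dagger (A ** B) = dagger B ** dagger A"
  by (simp add: dagger_def matrix_matrix_mult_def vec_eq_iff mult.commute)

lemma dagger_diff: "dagger (A - B) = dagger A - dagger B"
  by (simp add: dagger_def vec_eq_iff)

lemma dagger_dagger [simp]: "dagger (dagger A) = A"
  by (simp add: dagger_def vec_eq_iff)

lemma dagger_mat_1: "dagger (mat 1) = mat 1"
  by (auto simp: dagger_def mat_def vec_eq_iff)

lemma trace_dagger: "trace (dagger A) = cnj (trace A)"
  by (simp add: dagger_def trace_def)

lemma hs_norm_eq_norm: "hs_norm X = norm X"
proof -
  have "Re (trace (dagger X ** X)) = (\<Sum>i\<in>UNIV. \<Sum>j\<in>UNIV. (norm (X $ j $ i))\<^sup>2)"
    by (simp add: trace_def dagger_def matrix_matrix_mult_def cmod_power2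
        flip: power2_eq_square)
  also have "\<dots> = (\<Sum>j\<in>UNIV. \<Sum>i\<in>UNIV. (norm (X $ j $ i))\<^sup>2)"
    by (rule sum.swap)
  finally show ?thesis
    by (simp add: hs_norm_def norm_vec_def L2_set_def sum_nonneg)
qed

lemma trace_work_real:
  assumes "hermitian H" "hermitian \<rho>"
  shows "trace (H ** (\<rho> - W ** \<rho> ** dagger W)) \<in> \<real>"
proof -
  let ?X = "\<rho> - W ** \<rho> ** dagger W"
  have "dagger ?X = ?X"
    using assms(2) by (simp add: hermitian_def dagger_diff dagger_mult matrix_mul_assoc)
  then have "dagger (H ** ?X) = ?X ** H"
    using assms(1) by (simp add: hermitian_def dagger_mult)
  then have "cnj (trace (H ** ?X)) = trace (H ** ?X)"
    by (metis trace_dagger trace_mul_sym)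
  then show ?thesis
    by (simp add: Reals_cnj_iff)
qed

lemma compact_unitary_group: "compact (unitary_group :: (complex ^ 'n ^ 'n) set)"
proof -
  have "norm U = sqrt (real CARD('n))" if "U \<in> unitary_group" for U :: "complex ^ 'n ^ 'n"
    using that unfolding hs_norm_eq_norm[symmetric] hs_norm_def unitary_group_def
    by (simp add: trace_def mat_def)
  then have "bounded (unitary_group :: (complex ^ 'n ^ 'n) set)"
    by (metis bounded_iff order_refl)
  moreover have "closed (unitary_group :: (complex ^ 'n ^ 'n) set)"
    unfolding unitary_group_def dagger_def matrix_matrix_mult_def
    by (intro closed_Collect_conj closed_Collect_eq continuous_intros)
  ultimately show ?thesis
    by (simp add: compact_eq_bounded_closed)
qed

lemma ergotropy_is_max:
  obtains W where "W \<in> unitary_group"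
    "ergotropy H \<rho> = Re (trace (H ** (\<rho> - W ** \<rho> ** dagger W)))"
    "\<And>V. V \<in> unitary_group \<Longrightarrow> Re (trace (H ** (\<rho> - V ** \<rho> ** dagger V))) \<le> ergotropy H \<rho>"
proof -
  let ?f = "\<lambda>W. Re (trace (H ** (\<rho> - W ** \<rho> ** dagger W)))"
  have "continuous_on unitary_group ?f"
    unfolding trace_def dagger_def matrix_matrix_mult_def
    by (simp, intro continuous_intros)
  moreover have "mat 1 \<in> (unitary_group :: (complex ^ 'n ^ 'n) set)"
    by (simp add: unitary_group_def dagger_mat_1)
  ultimately obtain W where W: "W \<in> unitary_group" "\<And>V. V \<in> unitary_group \<Longrightarrow> ?f V \<le> ?f W"
    using continuous_attains_sup[OF compact_unitary_group, of ?f] by blast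
  have "ergotropy H \<rho> = ?f W"
    unfolding ergotropy_def by (rule Greatest_equality) (use W in auto)
  with W show thesis
    using that by auto
qed

end

theory Submission
  imports Defs
begin

text \<open>
  For a fixed \<open>W\<close>, the extracted work is \<open>Tr[H \<rho>] - Tr[W\<^sup>\<dagger> H W \<rho>]\<close>, and for a reduced state
  \<open>\<rho>\<close> of \<open>\<psi>\<close> one has \<open>Tr[K \<rho>] = \<langle>\<psi>| K \<otimes> 1 |\<psi>\<rangle>\<close>. On unit vectors this quadratic form is
  Lipschitz with constant \<open>2 \<parallel>K\<parallel>\<close>, and \<open>\<parallel>W\<^sup>\<dagger> H W\<parallel> \<le> \<parallel>H\<parallel>\<close>; so the work is Lipschitz with
  constant \<open>4 \<parallel>H\<parallel>\<close> uniformly in \<open>W\<close>, and so is its maximum over \<open>W\<close>. Finally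
  \<open>\<parallel>(U - V) \<psi>\<^sub>0\<parallel> \<le> \<parallel>U - V\<parallel>\<^sub>2\<close>.
\<close>

lemma inner_complex_eq_Re: "inner (a::complex) b = Re (cnj a * b)"
  by (simp add: inner_complex_def)

text \<open>On complex vectors \<open>inner\<close> is the real part of the Hermitian form, so the
  conjugate transpose is the adjoint for it as well.\<close>

lemma inner_matrix_vector_mult_dagger:
  fixes A :: "complex ^ 'n ^ 'm"
  shows "inner x (A *v y) = inner (dagger A *v x) y"
proof -
  have "inner x (A *v y) = Re (\<Sum>i\<in>UNIV. \<Sum>j\<in>UNIV. cnj (x $ i) * A $ i $ j * y $ j)"
    by (simp add: inner_vec_def inner_complex_eq_Re matrix_vector_mult_def sum_distrib_left
        mult.assoc del: complex_cnj_mult times_complex.sel)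
  also have "\<dots> = Re (\<Sum>j\<in>UNIV. \<Sum>i\<in>UNIV. cnj (x $ i) * A $ i $ j * y $ j)"
    by (subst sum.swap) simp
  also have "\<dots> = inner (dagger A *v x) y"
    by (simp add: inner_vec_def inner_complex_eq_Re matrix_vector_mult_def sum_distrib_left
        dagger_def mult_ac del: times_complex.sel)
  finally show ?thesis .
qed

lemma norm_unitary_mult:
  assumes "U \<in> unitary_group"
  shows "norm (U *v x) = norm x"
  using assms
  by (simp add: norm_eq_sqrt_inner inner_matrix_vector_mult_dagger unitary_group_def
      matrix_vector_mul_assoc)

lemma dagger_in_unitary_group: "U \<in> unitary_group \<Longrightarrow> dagger U \<in> unitary_group"
  by (simp add: unitary_group_def)

lemma norm_mult_le_spectral_norm: "norm (A *v x) \<le> spectral_norm A * norm x"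
  unfolding spectral_norm_def by (rule onorm) simp

lemma spectral_norm_nonneg: "0 \<le> spectral_norm A"
  unfolding spectral_norm_def by (rule onorm_pos_le) simp

lemma spectral_norm_unitary_conj_le:
  assumes "W \<in> unitary_group"
  shows "spectral_norm (dagger W ** A ** W) \<le> spectral_norm A"
  unfolding spectral_norm_def [of "dagger W ** A ** W"]
proof (rule onorm_bound[OF spectral_norm_nonneg])
  fix x
  have "norm ((dagger W ** A ** W) *v x) = norm (A *v (W *v x))"
    using norm_unitary_mult[OF dagger_in_unitary_group[OF assms]]
    by (simp flip: matrix_vector_mul_assoc)
  also have "\<dots> \<le> spectral_norm A * norm x"
    using norm_mult_le_spectral_norm[of A "W *v x"] norm_unitary_mult[OF assms] by simp
  finally show "norm ((dagger W ** A ** W) *v x) \<le> spectral_norm A * norm x" .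
qed

text \<open>Cauchy-Schwarz bounds each entry of \<open>X *v x\<close> by the norm of a row of
  \<open>X\<close> times \<open>norm x\<close>; the squares of the row norms add up to that of
  \<open>hs_norm X\<close>.\<close>

lemma norm_mult_le_hs_norm: "norm (X *v x) \<le> hs_norm X * norm x"
proof -
  have "norm ((X *v x) $ i) \<le> norm (X $ i) * norm x" for i
  proof -
    have "norm ((X *v x) $ i) \<le> (\<Sum>j\<in>UNIV. \<bar>norm (X $ i $ j)\<bar> * \<bar>norm (x $ j)\<bar>)"
      unfolding matrix_vector_mult_def by (auto intro!: sum_norm_le simp: norm_mult)
    also have "\<dots> \<le> norm (X $ i) * norm x"
      unfolding norm_vec_def by (rule L2_set_mult_ineq)
    finally show ?thesis .
  qed
  then have "norm (X *v x) \<le> L2_set (\<lambda>i. norm (X $ i) * norm x) UNIV"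
    unfolding norm_vec_def[of "X *v x"] by (intro L2_set_mono) auto
  also have "\<dots> = norm X * norm x"
    by (simp add: norm_vec_def[of X] L2_set_left_distrib)
  finally show ?thesis by (simp add: hs_norm_eq_norm)
qed

text \<open>
  In the next two definitions, \<open>\<complex>\<^sup>N \<otimes> \<complex>\<^sup>N\<^sup>'\<close> is identified with \<open>N'\<close>-tuples of vectors of \<open>\<complex>\<^sup>N\<close>,
  on which \<open>K \<otimes> 1\<close> acts slicewise.
\<close>

definition slices :: "complex ^ ('a::finite \<times> 'b::finite) \<Rightarrow> complex ^ 'a ^ 'b" where
  "slices \<psi> = (\<chi> k i. \<psi> $ (i, k))"

definition slicewise :: "complex ^ 'a ^ 'a \<Rightarrow> complex ^ 'a ^ 'b \<Rightarrow> complex ^ 'a ^ 'b" where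
  "slicewise K X = (\<chi> k. K *v X $ k)"

lemma slices_diff: "slices (\<psi> - \<phi>) = slices \<psi> - slices \<phi>"
  by (simp add: slices_def vec_eq_iff)

lemma slicewise_diff: "slicewise K (X - Y) = slicewise K X - slicewise K Y"
  by (simp add: slicewise_def vec_eq_iff matrix_vector_mult_diff_distrib)

lemma norm_slices: "norm (slices \<psi>) = norm \<psi>"
proof -
  have "(\<Sum>k\<in>UNIV. \<Sum>i\<in>UNIV. (norm (\<psi> $ (i, k)))\<^sup>2) = (\<Sum>p\<in>UNIV. (norm (\<psi> $ p))\<^sup>2)"
    by (subst sum.swap) (simp add: sum.cartesian_product)
  then show ?thesis
    by (simp add: norm_vec_def L2_set_def slices_def sum_nonneg)
qed

text \<open>The operator is block diagonal with all blocks equal to \<open>K\<close>, so the bound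
  for one block carries over whatever the number of slices.\<close>

lemma norm_slicewise_le: "norm (slicewise K X) \<le> spectral_norm K * norm X"
proof -
  have "norm (slicewise K X) \<le> L2_set (\<lambda>k. spectral_norm K * norm (X $ k)) UNIV"
    unfolding norm_vec_def[of "slicewise K X"]
    by (intro L2_set_mono) (auto simp: slicewise_def intro: norm_mult_le_spectral_norm)
  also have "\<dots> = spectral_norm K * norm X"
    by (simp add: norm_vec_def[of X] L2_set_right_distrib spectral_norm_nonneg)
  finally show ?thesis .
qed

text \<open>Partial trace is dual to tensoring with the identity: once the sums are reordered, the
  index that is traced out becomes the slice index.\<close>

lemma trace_partial_trace_ket_bra:
  "Re (trace (K ** partial_trace_B (ket_bra \<psi>))) = inner (slices \<psi>) (slicewise K (slices \<psi>))"
proof -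
  have "trace (K ** partial_trace_B (ket_bra \<psi>))
      = (\<Sum>i\<in>UNIV. \<Sum>j\<in>UNIV. \<Sum>k\<in>UNIV. cnj (\<psi> $ (i, k)) * (K $ i $ j * \<psi> $ (j, k)))"
    by (simp add: trace_def matrix_matrix_mult_def partial_trace_B_def ket_bra_def
        sum_distrib_left mult_ac)
  also have "\<dots> = (\<Sum>i\<in>UNIV. \<Sum>k\<in>UNIV. \<Sum>j\<in>UNIV. cnj (\<psi> $ (i, k)) * (K $ i $ j * \<psi> $ (j, k)))"
    by (intro sum.cong refl sum.swap)
  also have "\<dots> = (\<Sum>k\<in>UNIV. \<Sum>i\<in>UNIV. \<Sum>j\<in>UNIV. cnj (\<psi> $ (i, k)) * (K $ i $ j * \<psi> $ (j, k)))"
    by (rule sum.swap)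
  finally show ?thesis
    by (simp add: inner_vec_def inner_complex_eq_Re slices_def slicewise_def
        matrix_vector_mult_def sum_distrib_left del: times_complex.sel)
qed

lemma trace_partial_trace_ket_bra_lipschitz:
  assumes "norm \<psi> = 1" "norm \<phi> = 1"
  shows "\<bar>Re (trace (K ** partial_trace_B (ket_bra \<psi>)))
      - Re (trace (K ** partial_trace_B (ket_bra \<phi>)))\<bar> \<le> 2 * spectral_norm K * norm (\<psi> - \<phi>)"
proof -
  let ?s = "slices \<psi>" and ?t = "slices \<phi>" and ?K = "slicewise K"
  \<comment> \<open>The two arguments of the form are changed one at a time; each change costs
    \<open>spectral_norm K * norm (\<psi> - \<phi>)\<close>, whence the factor 2.\<close>
  have "inner ?s (?K ?s) - inner ?t (?K ?t) = inner (?s - ?t) (?K ?s) + inner ?t (?K (?s - ?t))"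
    by (simp add: slicewise_diff inner_diff_left inner_diff_right)
  moreover have "\<bar>inner (?s - ?t) (?K ?s)\<bar> \<le> norm (\<psi> - \<phi>) * spectral_norm K"
  proof -
    have "norm (?K ?s) \<le> spectral_norm K"
      using norm_slicewise_le[of K ?s] assms by (simp add: norm_slices)
    then show ?thesis
      using Cauchy_Schwarz_ineq2[of "?s - ?t" "?K ?s"]
      by (simp add: norm_slices flip: slices_diff)
        (meson mult_left_mono norm_ge_zero order_trans)
  qed
  moreover have "\<bar>inner ?t (?K (?s - ?t))\<bar> \<le> norm (\<psi> - \<phi>) * spectral_norm K"
    using Cauchy_Schwarz_ineq2[of ?t "?K (?s - ?t)"] norm_slicewise_le[of K "?s - ?t"] assms
    by (simp add: norm_slices mult.commute flip: slices_diff)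
  ultimately show ?thesis
    unfolding trace_partial_trace_ket_bra abs_le_iff by (simp add: mult_ac)
qed

lemma matrix_mult_diff_distrib:
  fixes A :: "'a::ring_1 ^ 'n ^ 'm"
  shows "A ** (B - C) = A ** B - A ** C"
  by (simp add: matrix_matrix_mult_def vec_eq_iff right_diff_distrib sum_subtractf)

text \<open>Cyclicity of the trace moves the unitaries from the state onto \<open>H\<close>, leaving
  traces of the state against fixed operators.\<close>

lemma trace_work_eq:
  "trace (H ** (\<rho> - W ** \<rho> ** dagger W)) = trace (H ** \<rho>) - trace (dagger W ** H ** W ** \<rho>)"
proof -
  have "trace (H ** (W ** \<rho> ** dagger W)) = trace (dagger W ** (H ** (W ** \<rho>)))"
    by (subst trace_mul_sym) (simp add: matrix_mul_assoc trace_mul_sym[of _ "dagger W"])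
  then show ?thesis
    by (simp add: matrix_mul_assoc matrix_mult_diff_distrib trace_sub)
qed

text \<open>A maximizer for \<open>\<rho>\<close> is still a competitor for \<open>\<sigma>\<close>,
  so the maxima differ by at most the difference of the two works at that \<open>W\<close>.\<close>

lemma ergotropy_diff_le:
  assumes "\<And>W. W \<in> unitary_group \<Longrightarrow>
    Re (trace (H ** (\<rho> - W ** \<rho> ** dagger W))) - Re (trace (H ** (\<sigma> - W ** \<sigma> ** dagger W))) \<le> c"
  shows "ergotropy H \<rho> - ergotropy H \<sigma> \<le> c"
proof -
  obtain W where W: "W \<in> unitary_group"
    "ergotropy H \<rho> = Re (trace (H ** (\<rho> - W ** \<rho> ** dagger W)))"
    by (rule ergotropy_is_max)
  moreover have "Re (trace (H ** (\<sigma> - W ** \<sigma> ** dagger W))) \<le> ergotropy H \<sigma>"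
    by (rule ergotropy_is_max[of H \<sigma>]) (use W in blast)
  ultimately show ?thesis
    using assms[of W] by linarith
qed

lemma ergotropy_reduced_state_diff_le:
  fixes H :: "complex ^ 'a ^ 'a" and \<psi>\<^sub>0 :: "complex ^ ('a::finite \<times> 'b::finite)"
  assumes "norm \<psi>\<^sub>0 = 1" "U \<in> unitary_group" "V \<in> unitary_group"
  shows "ergotropy H (reduced_state \<psi>\<^sub>0 U) - ergotropy H (reduced_state \<psi>\<^sub>0 V)
    \<le> 4 * spectral_norm H * hs_norm (U - V)"
proof (rule ergotropy_diff_le)
  fix W :: "complex ^ 'a ^ 'a"
  assume W: "W \<in> unitary_group"
  let ?\<rho> = "reduced_state \<psi>\<^sub>0 U" and ?\<sigma> = "reduced_state \<psi>\<^sub>0 V"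
  have dist: "norm (U *v \<psi>\<^sub>0 - V *v \<psi>\<^sub>0) \<le> hs_norm (U - V)"
    using norm_mult_le_hs_norm[of "U - V" \<psi>\<^sub>0] assms(1)
    by (simp add: matrix_vector_mult_diff_rdistrib)
  have lip: "\<bar>Re (trace (K ** ?\<rho>)) - Re (trace (K ** ?\<sigma>))\<bar> \<le> 2 * spectral_norm H * hs_norm (U - V)"
    if "spectral_norm K \<le> spectral_norm H" for K
  proof -
    have "\<bar>Re (trace (K ** ?\<rho>)) - Re (trace (K ** ?\<sigma>))\<bar>
        \<le> 2 * spectral_norm K * norm (U *v \<psi>\<^sub>0 - V *v \<psi>\<^sub>0)"
      unfolding reduced_state_def
      by (rule trace_partial_trace_ket_bra_lipschitz) (simp_all add: norm_unitary_mult assms)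
    also have "\<dots> \<le> 2 * spectral_norm H * hs_norm (U - V)"
      by (intro mult_mono) (use that dist spectral_norm_nonneg[of H] in \<open>auto simp: spectral_norm_nonneg\<close>)
    finally show ?thesis .
  qed
  show "Re (trace (H ** (?\<rho> - W ** ?\<rho> ** dagger W)))
      - Re (trace (H ** (?\<sigma> - W ** ?\<sigma> ** dagger W))) \<le> 4 * spectral_norm H * hs_norm (U - V)"
    \<comment> \<open>The operators \<open>H\<close> and \<open>dagger W ** H ** W\<close>
      contribute \<open>2 * spectral_norm H\<close> each, which makes the constant 4.\<close>
    using lip[OF order_refl] lip[OF spectral_norm_unitary_conj_le[OF W]]
    unfolding trace_work_eq by simp
qed

theorem lemma5:
  fixes n :: nat
    and H :: "complex ^ 'a ^ 'a"
    and \<psi>\<^sub>0 :: "complex ^ ('a::finite \<times> 'b::finite)"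
  assumes "CARD('a) = 2 ^ n"
    and "hermitian H"
    and "norm \<psi>\<^sub>0 = 1"
  shows "\<forall>U\<in>unitary_group. \<forall>V\<in>unitary_group.
    \<bar>ergotropy H (reduced_state \<psi>\<^sub>0 U) - ergotropy H (reduced_state \<psi>\<^sub>0 V)\<bar>
      \<le> 4 * spectral_norm H * hs_norm (U - V)"
proof (intro ballI)
  fix U V :: "complex ^ ('a \<times> 'b) ^ ('a \<times> 'b)"
  assume U: "U \<in> unitary_group" and V: "V \<in> unitary_group"
  \<comment> \<open>This symmetry turns the one-sided bound, applied to both orders of
    \<open>U\<close> and \<open>V\<close>, into one on the absolute value.\<close>
  have "hs_norm (V - U) = hs_norm (U - V)"
    by (simp add: hs_norm_eq_norm norm_minus_commute)
  then show "\<bar>ergotropy H (reduced_state \<psi>\<^sub>0 U) - ergotropy H (reduced_state \<psi>\<^sub>0 V)\<bar>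
      \<le> 4 * spectral_norm H * hs_norm (U - V)"
    using ergotropy_reduced_state_diff_le[OF assms(3) U V, of H]
      ergotropy_reduced_state_diff_le[OF assms(3) V U, of H] by (simp add: abs_le_iff)
qed

end
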